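(* Let $(I,+,\preceq_I,\ast)$ be a partially ordered commutative ring. Let $x_1,\dots,x_6\in I$ with $x_i\succeq_I x_{i+1}$ for $1\leq i\leq 5$ and $x_1+x_6\succeq_I x_2+x_5\succeq_I x_3+x_4$, and let $n\geq 0$ be an integer. Suppose that the multiplicative inverse $(x_2-x_6)^{-1}$ exists in $I$ and $(x_2-x_6)^{-1}\succ_I 0$. Let $a_1,\dots,a_6\in I$ and suppose that for each $i\in\{2,4,6\}$ there is an upper bound $\hat a_i\in I$ of $\{a_i,-a_i\}$ such that $a_1\succeq_I\hat a_2\succeq_I a_5\succeq_I\hat a_6\succeq_I 0$ and $a_3\succeq_I\hat a_4\succeq_I 0$. Then $$\sum_{i=1}^6 a_i\ast\prod_{\substack{1\leq j\leq 6\\ j\neq i}}(x_i-x_j)^n\succeq_I 0,$$ where the product is taken with respect to $\ast$.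
   Context: A partially ordered Abelian group $(I,+,\preceq_I)$ is an Abelian group with a partial order such that $x+z\preceq_I y+z\Leftrightarrow x\preceq_I y$ for all $x,y,z\in I$. A partially ordered commutative ring $(I,+,\preceq_I,\ast)$ is a partially ordered Abelian group together with an operation $\ast:I\times I\to I$ that is associative, commutative, distributive over $+$, nonnegativity-preserving ($x\succeq_I 0$ and $y\succeq_I 0$ imply $x\ast y\succeq_I 0$), and has an identity element in $I$. Powers $x^n$ and inverses are with respect to $\ast$. An element $u$ is an upper bound of $S\subset I$ if $u\succeq_I s$ for all $s\in S$. *)

theory Defs
  imports Main
begin

text \<open>
  Partially ordered commutative rings with identity are rendered by the sort
  \<open>{comm_ring_1, ordered_comm_ring}\<close>: the order is partial, translations are monotone, and
  (over a ring) monotonicity of multiplication by a nonnegative element is the same as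
  closure of the nonnegative elements under multiplication.  Nothing is assumed about the
  sign of the identity element or about squares.  The axiom \<open>0 \<noteq> 1\<close> of \<open>comm_ring_1\<close> only excludes
  the zero ring, which has no strictly positive element.
\<close>

end

theory Submission
  imports Defs
begin

text \<open>
  Write \<open>x\<^sub>i\<^sub>j\<close> for the gap between \<open>x\<^sub>i\<close> and \<open>x\<^sub>j\<close>, and \<open>P\<^sub>i\<close> for the product of the \<open>n\<close>-th powers
  of the five gaps at \<open>x\<^sub>i\<close>.  The odd terms are \<open>a\<^sub>i P\<^sub>i\<close>, and the even ones are at least minus the
  bound of \<open>a\<^sub>i\<close> times \<open>P\<^sub>i\<close>.  By the chains of coefficients it is enough that \<open>P\<^sub>4 \<le> P\<^sub>3\<close>,
  \<open>P\<^sub>2 \<le> P\<^sub>1\<close> and \<open>P\<^sub>2 + P\<^sub>6 \<le> P\<^sub>1 + P\<^sub>5\<close>.  For the last of these, \<open>P\<^sub>1\<close> and \<open>P\<^sub>5\<close> contain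
  the \<open>n\<close>-th power of \<open>x\<^sub>1\<^sub>5\<close>, \<open>P\<^sub>2\<close> and \<open>P\<^sub>6\<close> that of \<open>x\<^sub>2\<^sub>6\<close>, and \<open>x\<^sub>2\<^sub>6 \<le> x\<^sub>1\<^sub>5\<close>.  After these
  factors are removed the bases satisfy \<open>r\<^sub>5 \<le> r\<^sub>2\<close>, \<open>r\<^sub>6 \<le> r\<^sub>1\<close> and \<open>r\<^sub>6 - r\<^sub>5 \<le> r\<^sub>1 - r\<^sub>2\<close>, and these
  inequalities pass to \<open>n\<close>-th powers without any comparison of \<open>r\<^sub>2\<close> with \<open>r\<^sub>6\<close>.
\<close>

text \<open>The identity may fail to be nonnegative in this class, so the exponent \<open>0\<close>
  needs \<open>0 \<le> 1\<close> as a hypothesis.\<close>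

lemma zero_le_power_if_zero_le_one:
  fixes a :: "'a :: {comm_ring_1, ordered_comm_ring}"
  assumes "0 \<le> (1 :: 'a)" "0 \<le> a"
  shows "0 \<le> a ^ n"
  by (induction n) (simp_all add: assms)

lemma power_mono_if_zero_le_one:
  fixes a b :: "'a :: {comm_ring_1, ordered_comm_ring}"
  assumes "0 \<le> (1 :: 'a)" "0 \<le> a" "a \<le> b"
  shows "a ^ n \<le> b ^ n"
proof (induction n)
  case (Suc n)
  have "0 \<le> b"
    using assms by (meson order_trans)
  then show ?case
    using assms Suc by (auto intro!: mult_mono zero_le_power_if_zero_le_one)
qed simp

text \<open>Each difference of powers is the difference of its bases times a sum of mixed monomials,
  where \<open>c\<close> is compared only with \<open>b\<close> and \<open>d\<close> only with
  \<open>a\<close>.\<close>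

lemma power_diff_mono:
  fixes a b c d :: "'a :: {comm_ring_1, ordered_comm_ring}"
  assumes one: "0 \<le> (1 :: 'a)"
    and "0 \<le> c" "c \<le> d" "c \<le> b" "d \<le> a" "d - c \<le> a - b"
  shows "d ^ n - c ^ n \<le> a ^ n - b ^ n"
proof -
  have nonneg: "0 \<le> d" "0 \<le> b" "0 \<le> a" "0 \<le> d - c" "0 \<le> a - b"
    using assms by (meson order_trans diff_ge_0_iff_ge)+
  have "(\<Sum>i<n. c ^ (n - Suc i) * d ^ i) \<le> (\<Sum>i<n. b ^ (n - Suc i) * a ^ i)"
    using assms nonneg
    by (intro sum_mono mult_mono power_mono_if_zero_le_one zero_le_power_if_zero_le_one) auto
  moreover have "0 \<le> (\<Sum>i<n. c ^ (n - Suc i) * d ^ i)"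
    using assms nonneg
    by (intro sum_nonneg mult_nonneg_nonneg zero_le_power_if_zero_le_one) auto
  ultimately show ?thesis
    unfolding power_diff_sumr2 using assms nonneg by (intro mult_mono) auto
qed

text \<open>The right side exceeds the left by \<open>(u - v) * g\<close>.\<close>

lemma cross_mult_le:
  fixes u v g :: "'a :: ordered_comm_ring"
  assumes "v \<le> u" "0 \<le> g"
  shows "(u + g) * v \<le> u * (v + g)"
  using mult_right_mono[OF assms] by (simp add: algebra_simps)

text \<open>The sign of \<open>q - p\<close> is unknown, so \<open>M\<close> is enlarged to
  \<open>K\<close> only after passing to the nonnegative \<open>r - s\<close>.\<close>

lemma three_term_diff_mono:
  fixes K M p q r s :: "'a :: ordered_comm_ring"
  assumes "0 \<le> M" "M \<le> K" "s \<le> r" "q - p \<le> r - s"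
  shows "K * s - M * p \<le> K * r - M * q"
proof -
  have "M * (q - p) \<le> M * (r - s)"
    using assms by (intro mult_left_mono)
  also have "\<dots> \<le> K * (r - s)"
    using assms by (intro mult_right_mono) auto
  finally show ?thesis
    by (simp add: algebra_simps)
qed

context
  fixes x1 x2 x3 x4 x5 x6 :: "'a :: {comm_ring_1, ordered_comm_ring}"
  assumes one: "0 \<le> (1 :: 'a)"
    and dec: "x2 \<le> x1" "x3 \<le> x2" "x4 \<le> x3" "x5 \<le> x4" "x6 \<le> x5"
    and sums: "x2 + x5 \<le> x1 + x6" "x3 + x4 \<le> x2 + x5"
begin

lemma nonneg_gaps:
  "0 \<le> x1 - x2" "0 \<le> x1 - x3" "0 \<le> x1 - x4" "0 \<le> x1 - x5" "0 \<le> x1 - x6"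
  "0 \<le> x2 - x3" "0 \<le> x2 - x4" "0 \<le> x2 - x5" "0 \<le> x2 - x6"
  "0 \<le> x3 - x4" "0 \<le> x3 - x5" "0 \<le> x3 - x6"
  "0 \<le> x4 - x5" "0 \<le> x4 - x6" "0 \<le> x5 - x6"
  using dec by (simp_all; meson order_trans)+

text \<open>The first six compare a gap with its mirror image under the index reversal from
  \<open>i\<close> to \<open>7 - i\<close>, which restates an inequality between sums; the last
  three are nested gaps.\<close>

lemma gap_le:
  "x5 - x6 \<le> x1 - x2" "x4 - x5 \<le> x2 - x3" "x4 - x6 \<le> x1 - x3" "x3 - x6 \<le> x1 - x4"
  "x3 - x5 \<le> x2 - x4" "x2 - x6 \<le> x1 - x5"
  "x2 - x5 \<le> x1 - x6" "x3 - x5 \<le> x3 - x6" "x4 - x5 \<le> x4 - x6"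
proof -
  show "x5 - x6 \<le> x1 - x2" "x4 - x5 \<le> x2 - x3" "x3 - x5 \<le> x2 - x4" "x2 - x6 \<le> x1 - x5"
    using sums by (simp_all add: algebra_simps)
  have "x3 + x4 \<le> x1 + x6"
    using sums order_trans by blast
  then show "x4 - x6 \<le> x1 - x3" "x3 - x6 \<le> x1 - x4"
    by (simp_all add: algebra_simps)
  show "x2 - x5 \<le> x1 - x6" "x3 - x5 \<le> x3 - x6" "x4 - x5 \<le> x4 - x6"
    using dec by (auto intro: diff_mono)
qed

text \<open>Moving from \<open>x4\<close> to \<open>x3\<close> shortens a gap to the left and
  lengthens one to the right by the same \<open>x3 - x4\<close>, so \<open>cross_mult_le\<close>
  applies to each of two such pairs.\<close>

lemma product_4_le_3:
  "(x1 - x4) * (x2 - x4) * (x3 - x4) * (x4 - x5) * (x4 - x6)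
    \<le> (x1 - x3) * (x2 - x3) * (x3 - x4) * (x3 - x5) * (x3 - x6)"
proof -
  have "(x2 - x4) * (x4 - x5) \<le> (x2 - x3) * (x3 - x5)"
    using cross_mult_le[OF gap_le(2) nonneg_gaps(10)] by simp
  moreover have "(x1 - x4) * (x4 - x6) \<le> (x1 - x3) * (x3 - x6)"
    using cross_mult_le[OF gap_le(3) nonneg_gaps(10)] by simp
  ultimately have "((x2 - x4) * (x4 - x5)) * ((x1 - x4) * (x4 - x6))
      \<le> ((x2 - x3) * (x3 - x5)) * ((x1 - x3) * (x3 - x6))"
    by (rule mult_mono) (use nonneg_gaps in \<open>auto intro!: mult_nonneg_nonneg simp del: diff_ge_0_iff_ge\<close>)
  then have "(x3 - x4) * (((x2 - x4) * (x4 - x5)) * ((x1 - x4) * (x4 - x6)))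
      \<le> (x3 - x4) * (((x2 - x3) * (x3 - x5)) * ((x1 - x3) * (x3 - x6)))"
    using nonneg_gaps by (intro mult_left_mono)
  then show ?thesis
    by (simp only: mult_ac)
qed

lemma product_2_le_1:
  "(x1 - x2) * (x2 - x3) * (x2 - x4) * (x2 - x5) * (x2 - x6)
    \<le> (x1 - x2) * (x1 - x3) * (x1 - x4) * (x1 - x5) * (x1 - x6)"
  using nonneg_gaps dec by (intro mult_mono mult_nonneg_nonneg diff_right_mono) simp_all

text \<open>The sides factor as \<open>(x5 - x6) * ?V\<close> and \<open>(x1 - x2) * ?U\<close>,
  which leaves \<open>0 \<le> ?V\<close> and \<open>?V \<le> ?U\<close>.\<close>

lemma reduced_product_diff_le:
  "(x1 - x6) * (x5 - x6) * (x4 - x6) * (x3 - x6) - (x5 - x6) * (x4 - x5) * (x3 - x5) * (x2 - x5)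
    \<le> (x1 - x6) * (x1 - x2) * (x1 - x3) * (x1 - x4) - (x1 - x2) * (x2 - x3) * (x2 - x4) * (x2 - x5)"
proof -
  let ?V = "(x1 - x6) * ((x4 - x6) * (x3 - x6)) - (x2 - x5) * ((x4 - x5) * (x3 - x5))"
  let ?U = "(x1 - x6) * ((x1 - x3) * (x1 - x4)) - (x2 - x5) * ((x2 - x3) * (x2 - x4))"
  \<comment> \<open>Both sides are expansions of the form
    \<open>(p + e) * (q + e) - p * q = e * (p + q + e)\<close>, with \<open>e\<close> equal to
    \<open>x5 - x6\<close> and \<open>x1 - x2\<close>.\<close>
  have "(x5 - x6) * ((x4 - x6) + (x3 - x5)) \<le> (x1 - x2) * ((x1 - x3) + (x2 - x4))"
    using nonneg_gaps gap_le by (intro mult_mono add_mono add_nonneg_nonneg)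
  then have "(x2 - x3) * (x2 - x4) - (x4 - x5) * (x3 - x5)
      \<le> (x1 - x3) * (x1 - x4) - (x4 - x6) * (x3 - x6)"
    by (simp add: algebra_simps)
  then have UV: "?V \<le> ?U"
    using nonneg_gaps gap_le
    by (intro three_term_diff_mono mult_mono)
  have V: "0 \<le> ?V"
    unfolding diff_ge_0_iff_ge[of "_ * _"]
    using nonneg_gaps gap_le by (intro mult_mono mult_nonneg_nonneg)
  then have "(x5 - x6) * ?V \<le> (x1 - x2) * ?U"
    using nonneg_gaps gap_le UV by (intro mult_mono)
  then show ?thesis
    unfolding right_diff_distrib[of _ "_ * _" "_ * _"] by (simp only: mult_ac)
qed

lemma power_product_sum_le:
  "((x1 - x2) * (x2 - x3) * (x2 - x4) * (x2 - x5) * (x2 - x6)) ^ n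
      + ((x1 - x6) * (x2 - x6) * (x3 - x6) * (x4 - x6) * (x5 - x6)) ^ n
    \<le> ((x1 - x2) * (x1 - x3) * (x1 - x4) * (x1 - x5) * (x1 - x6)) ^ n
      + ((x1 - x5) * (x2 - x5) * (x3 - x5) * (x4 - x5) * (x5 - x6)) ^ n"
proof -
  \<comment> \<open>The factors are ordered so that \<open>r5 \<le> r2\<close> and
    \<open>r6 \<le> r1\<close> hold factor by factor.\<close>
  define r1 where "r1 = (x1 - x6) * (x1 - x2) * (x1 - x3) * (x1 - x4)"
  define r2 where "r2 = (x1 - x2) * (x2 - x3) * (x2 - x4) * (x2 - x5)"
  define r5 where "r5 = (x5 - x6) * (x4 - x5) * (x3 - x5) * (x2 - x5)"
  define r6 where "r6 = (x1 - x6) * (x5 - x6) * (x4 - x6) * (x3 - x6)"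
  have nonneg: "0 \<le> r1" "0 \<le> r2" "0 \<le> r5" "0 \<le> r6"
    unfolding r1_def r2_def r5_def r6_def
    using nonneg_gaps by (auto intro!: mult_nonneg_nonneg simp del: diff_ge_0_iff_ge)
  have "r5 \<le> r2" "r6 \<le> r1"
    unfolding r1_def r2_def r5_def r6_def
    using nonneg_gaps gap_le
    by (auto intro!: mult_mono mult_nonneg_nonneg simp del: diff_ge_0_iff_ge)
  moreover have "r5 \<le> r6"
  proof -
    have "(x2 - x5) * (x5 - x6) * (x4 - x5) * (x3 - x5) \<le> r6"
      unfolding r6_def using nonneg_gaps gap_le
      by (intro mult_mono mult_nonneg_nonneg order_refl)
    then show ?thesis
      unfolding r5_def by (simp only: mult_ac)
  qed
  moreover have "r6 - r5 \<le> r1 - r2"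
    unfolding r1_def r2_def r5_def r6_def by (rule reduced_product_diff_le)
  ultimately have "r6 ^ n - r5 ^ n \<le> r1 ^ n - r2 ^ n"
    using one nonneg by (intro power_diff_mono)
  then have "r2 ^ n + r6 ^ n \<le> r1 ^ n + r5 ^ n"
    by (simp add: algebra_simps)
  then have "(x2 - x6) ^ n * (r2 ^ n + r6 ^ n) \<le> (x1 - x5) ^ n * (r1 ^ n + r5 ^ n)"
    using one nonneg nonneg_gaps gap_le
    by (intro mult_mono power_mono_if_zero_le_one add_nonneg_nonneg zero_le_power_if_zero_le_one)
  then show ?thesis
    unfolding r1_def r2_def r5_def r6_def
    by (simp only: power_mult_distrib distrib_left mult_ac)
qed

end

text \<open>Splitting \<open>b2\<close> as \<open>a5 + (b2 - a5)\<close> puts the weight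
  \<open>a5\<close> on the sum inequality and the nonnegative rest on
  \<open>P2 \<le> P1\<close>.\<close>

lemma alternating_combination_nonneg:
  fixes P1 P2 P3 P4 P5 P6 :: "'a :: ordered_comm_ring"
  assumes P: "0 \<le> P1" "0 \<le> P3" "0 \<le> P5" "0 \<le> P6" "P4 \<le> P3" "P2 \<le> P1" "P2 + P6 \<le> P1 + P5"
    and b: "b2 \<le> a1" "a5 \<le> b2" "b6 \<le> a5" "0 \<le> b6" "b4 \<le> a3" "0 \<le> b4"
  shows "b2 * P2 + b4 * P4 + b6 * P6 \<le> a1 * P1 + a3 * P3 + a5 * P5"
proof -
  have "0 \<le> a5"
    using b by (meson order_trans)
  have "a5 * (P2 + P6) \<le> a5 * (P1 + P5)"
    using P \<open>0 \<le> a5\<close> by (intro mult_left_mono)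
  moreover have "(b2 - a5) * P2 \<le> (b2 - a5) * P1"
    using P b by (intro mult_left_mono) auto
  ultimately have "b2 * P2 + a5 * P6 \<le> b2 * P1 + a5 * P5"
    using add_mono by (fastforce simp: algebra_simps)
  moreover have "b6 * P6 \<le> a5 * P6" "b2 * P1 \<le> a1 * P1"
    using P b by (auto intro: mult_right_mono)
  ultimately have "b2 * P2 + b6 * P6 \<le> a1 * P1 + a5 * P5"
    by (meson add_left_mono add_right_mono order_trans)
  moreover have "b4 * P4 \<le> a3 * P3"
    using P b by (meson mult_left_mono mult_right_mono order_trans)
  ultimately have "(b2 * P2 + b6 * P6) + b4 * P4 \<le> (a1 * P1 + a5 * P5) + a3 * P3"
    by (rule add_mono)
  then show ?thesis
    by (simp only: ac_simps)
qed

theorem theorem13: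
  fixes x a ahat :: "nat \<Rightarrow> 'a :: {comm_ring_1, ordered_comm_ring}"
    and y :: 'a
    and n :: nat
  assumes x_decreasing: "\<forall>i\<in>{1..5}. x i \<ge> x (i + 1)"
    and x_sums: "x 1 + x 6 \<ge> x 2 + x 5" "x 2 + x 5 \<ge> x 3 + x 4"
    and y_inverse: "(x 2 - x 6) * y = 1"
    and y_pos: "y > 0"
    and ahat_upper_bound: "\<forall>i\<in>{2, 4, 6}. \<forall>s\<in>{a i, - a i}. ahat i \<ge> s"
    and a_chain: "a 1 \<ge> ahat 2" "ahat 2 \<ge> a 5" "a 5 \<ge> ahat 6" "ahat 6 \<ge> 0"
    and a_chain': "a 3 \<ge> ahat 4" "ahat 4 \<ge> 0"
  shows "(\<Sum>i = 1..6. a i * (\<Prod>j\<in>{1..6} - {i}. (x i - x j) ^ n)) \<ge> 0"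
proof -
  have dec: "x 2 \<le> x 1" "x 3 \<le> x 2" "x 4 \<le> x 3" "x 5 \<le> x 4" "x 6 \<le> x 5"
    using x_decreasing[rule_format, of 1] x_decreasing[rule_format, of 2]
      x_decreasing[rule_format, of 3] x_decreasing[rule_format, of 4]
      x_decreasing[rule_format, of 5]
    by (simp_all add: numeral_eq_Suc)
  \<comment> \<open>The sign of the identity comes from the invertible gap: \<open>1\<close> is a
    product of two nonnegative elements.\<close>
  have "0 \<le> (x 2 - x 6) * y"
    using dec y_pos by (intro mult_nonneg_nonneg) (auto intro: order_trans)
  then have one: "0 \<le> (1 :: 'a)"
    by (simp add: y_inverse)
  note ctx = one dec x_sums
  define P1 where "P1 = ((x 1 - x 2) * (x 1 - x 3) * (x 1 - x 4) * (x 1 - x 5) * (x 1 - x 6)) ^ n"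
  define P2 where "P2 = ((x 1 - x 2) * (x 2 - x 3) * (x 2 - x 4) * (x 2 - x 5) * (x 2 - x 6)) ^ n"
  define P3 where "P3 = ((x 1 - x 3) * (x 2 - x 3) * (x 3 - x 4) * (x 3 - x 5) * (x 3 - x 6)) ^ n"
  define P4 where "P4 = ((x 1 - x 4) * (x 2 - x 4) * (x 3 - x 4) * (x 4 - x 5) * (x 4 - x 6)) ^ n"
  define P5 where "P5 = ((x 1 - x 5) * (x 2 - x 5) * (x 3 - x 5) * (x 4 - x 5) * (x 5 - x 6)) ^ n"
  define P6 where "P6 = ((x 1 - x 6) * (x 2 - x 6) * (x 3 - x 6) * (x 4 - x 6) * (x 5 - x 6)) ^ n"
  note P_defs = P1_def P2_def P3_def P4_def P5_def P6_def
  have P_nonneg: "0 \<le> P1" "0 \<le> P2" "0 \<le> P3" "0 \<le> P4" "0 \<le> P5" "0 \<le> P6"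
    unfolding P_defs using one nonneg_gaps[OF ctx]
    by (auto intro!: zero_le_power_if_zero_le_one mult_nonneg_nonneg simp del: diff_ge_0_iff_ge)
  have "P4 \<le> P3" "P2 \<le> P1"
    unfolding P_defs
    using one nonneg_gaps[OF ctx] product_4_le_3[OF ctx] product_2_le_1[OF ctx]
    by (auto intro!: power_mono_if_zero_le_one mult_nonneg_nonneg simp del: diff_ge_0_iff_ge)
  moreover have "P2 + P6 \<le> P1 + P5"
    unfolding P_defs by (rule power_product_sum_le[OF ctx])
  ultimately have main: "ahat 2 * P2 + ahat 4 * P4 + ahat 6 * P6 \<le> a 1 * P1 + a 3 * P3 + a 5 * P5"
    using P_nonneg a_chain a_chain' by (intro alternating_combination_nonneg)
  \<comment> \<open>Each reversed gap contributes one factor \<open>s\<close>. The product at index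
    \<open>i\<close> has \<open>i - 1\<close> of them, so one \<open>s\<close> survives exactly for
    even \<open>i\<close>.\<close>
  define s :: 'a where "s = (- 1) ^ n"
  have ss: "s * s = 1" "s * (s * t) = t" for t
    by (simp_all add: s_def flip: mult.assoc power_mult_distrib)
  have swap: "(u - v) ^ n = s * (v - u) ^ n" for u v :: 'a
    by (metis minus_diff_eq power_minus s_def)
  \<comment> \<open>As \<open>s\<close> is \<open>1\<close> or \<open>- 1\<close>, bounding both
    \<open>a i\<close> and \<open>- a i\<close> covers either parity of \<open>n\<close>.\<close>
  have bound: "- ahat i * P \<le> s * a i * P" if "i \<in> {2, 4, 6}" "0 \<le> P" for i P
  proof -
    have "a i \<le> ahat i" "- a i \<le> ahat i"
      using ahat_upper_bound that by blast+
    then have "- ahat i \<le> s * a i"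
      by (cases "even n") (simp_all add: s_def minus_le_iff)
    then show ?thesis
      using that by (intro mult_right_mono)
  qed
  have sets: "{1..6} = {1, 2, 3, 4, 5, 6 :: nat}"
    by auto
  have diffs: "{1, 2, 3, 4, 5, 6} - {1} = {2, 3, 4, 5, 6 :: nat}"
    "{1, 2, 3, 4, 5, 6} - {2} = {1, 3, 4, 5, 6 :: nat}"
    "{1, 2, 3, 4, 5, 6} - {3} = {1, 2, 4, 5, 6 :: nat}"
    "{1, 2, 3, 4, 5, 6} - {4} = {1, 2, 3, 5, 6 :: nat}"
    "{1, 2, 3, 4, 5, 6} - {5} = {1, 2, 3, 4, 6 :: nat}"
    "{1, 2, 3, 4, 5, 6} - {6} = {1, 2, 3, 4, 5 :: nat}"
    by auto
  define F where "F i = (\<Prod>j\<in>{1..6} - {i}. (x i - x j) ^ n)" for i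
  have F1: "F 1 = P1"
    unfolding F_def P1_def sets diffs by (simp add: power_mult_distrib mult_ac)
  have F2: "F 2 = s * P2"
    unfolding F_def P2_def sets diffs
    by (simp add: power_mult_distrib swap[of "x 2" "x 1"] mult_ac del: One_nat_def)
  have F3: "F 3 = P3"
    unfolding F_def P3_def sets diffs
    by (simp add: power_mult_distrib swap[of "x 3" "x 1"] swap[of "x 3" "x 2"] mult_ac ss del: One_nat_def)
  have F4: "F 4 = s * P4"
    unfolding F_def P4_def sets diffs
    by (simp add: power_mult_distrib swap[of "x 4" "x 1"] swap[of "x 4" "x 2"]
        swap[of "x 4" "x 3"] mult_ac ss del: One_nat_def)
  have F5: "F 5 = P5"
    unfolding F_def P5_def sets diffs
    by (simp add: power_mult_distrib swap[of "x 5" "x 1"] swap[of "x 5" "x 2"]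
        swap[of "x 5" "x 3"] swap[of "x 5" "x 4"] mult_ac ss del: One_nat_def)
  have F6: "F 6 = s * P6"
    unfolding F_def P6_def sets diffs
    by (simp add: power_mult_distrib swap[of "x 6" "x 1"] swap[of "x 6" "x 2"]
        swap[of "x 6" "x 3"] swap[of "x 6" "x 4"] swap[of "x 6" "x 5"] mult_ac ss del: One_nat_def)
  have "0 \<le> (a 1 * P1 + a 3 * P3 + a 5 * P5) + (- ahat 2 * P2 + - ahat 4 * P4 + - ahat 6 * P6)"
    using main by (simp add: algebra_simps)
  also have "\<dots> \<le> (a 1 * P1 + a 3 * P3 + a 5 * P5) + (s * a 2 * P2 + s * a 4 * P4 + s * a 6 * P6)"
    using P_nonneg by (intro add_left_mono add_mono bound) auto
  also have "\<dots> = (\<Sum>i = 1..6. a i * F i)"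
    unfolding sets by (simp add: F1 F2 F3 F4 F5 F6 algebra_simps del: One_nat_def)
  finally show ?thesis
    unfolding F_def .
qed

end
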